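(* Let $V$ be a finite-dimensional real vector space. A complex subspace $L$ of $(V\oplus V^* )^{\mathbb C}$ is the holomorphic space of a symmetric generalized complex structure on $V$ if and only if it is of the form $$L=L^-(E,\alpha):=\{X+\xi\in E\oplus(V^{\mathbb C})^*:\ \xi|_{\bar E}=i_X\alpha\},$$ where $E$ is a complex subspace of $V^{\mathbb C}$ with $E+\bar E=V^{\mathbb C}$ and $\alpha\in E^*\otimes\bar E^*$ is a complex bilinear form satisfying: (i) $\alpha$ is skew-Hermitian, i.e. $\alpha(X,\bar Y)+\overline{\alpha(Y,\bar X)}=0$ for all $X,Y\in E$; (ii) $\mathrm{Im}(\alpha|_\Delta)$ is non-degenerate, where $\Delta\subset V$ is the real part of $E\cap\bar E$, i.e. $\Delta^{\mathbb C}=E\cap\bar E$.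
   Context: On $V\oplus V^*$ consider the metric $g_{\mathrm{can}}(X+\xi,Y+\eta)=\frac12(\xi(Y)+\eta(X))$. A symmetric generalized complex structure on $V$ is an endomorphism $\mathcal J$ of $V\oplus V^*$, symmetric with respect to $g_{\mathrm{can}}$, with $\mathcal J^2=-\mathrm{Id}$. Its holomorphic space is its $i$-eigenspace in $(V\oplus V^* )^{\mathbb C}$. For a complex subspace $E\subset V^{\mathbb C}$, $\bar E$ is its image under the conjugation of $V^{\mathbb C}$ with respect to $V$ (a complex subspace of $V^{\mathbb C}$). $i_X\alpha=\alpha(X,\cdot)\in\bar E^*$. $\alpha|_\Delta$ is the restriction of $\alpha$ to $\Delta\times\Delta$, and $\mathrm{Im}$ is the imaginary part, giving a real bilinear form on $\Delta$. *)

theory Defs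
  imports "HOL-Analysis.Analysis" "HOL-Library.Set_Algebras"
begin

section \<open>The dual of a real vector space\<close>

typedef (overloaded) 'v dual = "{f :: 'v::real_vector \<Rightarrow> real. linear f}"
  morphisms dual_apply Abs_dual
  by (rule exI [of _ "\<lambda>_. 0"]) (simp add: module_hom_zero)

setup_lifting type_definition_dual

instantiation dual :: (real_vector) real_vector
begin

lift_definition zero_dual :: "'a dual" is "\<lambda>_. 0"
  by (simp add: module_hom_zero)

lift_definition plus_dual :: "'a dual \<Rightarrow> 'a dual \<Rightarrow> 'a dual" is "\<lambda>f g x. f x + g x"
  by (rule linear_compose_add)

lift_definition uminus_dual :: "'a dual \<Rightarrow> 'a dual" is "\<lambda>f x. - f x"
  by (rule linear_compose_neg)

lift_definition minus_dual :: "'a dual \<Rightarrow> 'a dual \<Rightarrow> 'a dual" is "\<lambda>f g x. f x - g x"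
  by (rule linear_compose_sub)

lift_definition scaleR_dual :: "real \<Rightarrow> 'a dual \<Rightarrow> 'a dual" is "\<lambda>r f x. r * f x"
  using linear_compose_scale_right by fastforce

instance
  by (standard; transfer; simp add: algebra_simps)

end

lemma linear_dual_apply: "linear (dual_apply f)"
  using dual_apply by blast


section \<open>Complexification\<close>

text \<open>\<open>Cplx x y\<close> stands for \<open>x + iy\<close>. For a real-linear map \<open>f\<close>, the complex-linear extension
  of \<open>f\<close> is the functorial action \<open>map_complexification f\<close>.\<close>

datatype 'a complexification = Cplx (re_part: 'a) (im_part: 'a)

instantiation complexification :: (ab_group_add) ab_group_add
begin

definition zero_complexification :: "'a complexification" where
  "0 = Cplx 0 0"

definition plus_complexification where
  "w + z = Cplx (re_part w + re_part z) (im_part w + im_part z)"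

definition uminus_complexification where
  "- w = Cplx (- re_part w) (- im_part w)"

definition minus_complexification where
  "w - z = Cplx (re_part w - re_part z) (im_part w - im_part z)"

instance
  by standard
    (simp_all add: zero_complexification_def plus_complexification_def
      uminus_complexification_def minus_complexification_def algebra_simps)

end

definition cscale :: "complex \<Rightarrow> 'a::real_vector complexification \<Rightarrow> 'a complexification" where
  "cscale c w = Cplx (Re c *\<^sub>R re_part w - Im c *\<^sub>R im_part w)
                     (Re c *\<^sub>R im_part w + Im c *\<^sub>R re_part w)"

global_interpretation complexification: vector_space cscale
  by standard
    (simp_all add: cscale_def plus_complexification_def algebra_simps)

definition of_real_part :: "'a::zero \<Rightarrow> 'a complexification" where
  "of_real_part x = Cplx x 0"

definition cconj :: "'a::ab_group_add complexification \<Rightarrow> 'a complexification" where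
  "cconj w = Cplx (re_part w) (- im_part w)"

definition real_points :: "'a::zero complexification set \<Rightarrow> 'a set" where
  "real_points S = {x. of_real_part x \<in> S}"

text \<open>Identification of the complexification of the dual space with the space of complex-linear
  functionals on the complexification: \<open>(f + ig)(x + iy) = (f x - g y) + i (f y + g x)\<close>.\<close>

definition cdual_apply ::
    "'v::real_vector dual complexification \<Rightarrow> 'v complexification \<Rightarrow> complex" where
  "cdual_apply \<xi> Z =
     Complex (dual_apply (re_part \<xi>) (re_part Z)) (dual_apply (re_part \<xi>) (im_part Z)) +
     \<i> * Complex (dual_apply (im_part \<xi>) (re_part Z)) (dual_apply (im_part \<xi>) (im_part Z))"

lemma bij_betw_cdual_apply:
  "bij_betw cdual_apply UNIV
     {\<phi> :: 'v::real_vector complexification \<Rightarrow> complex. Vector_Spaces.linear cscale (*) \<phi>}"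
  unfolding bij_betw_def
proof
  show "inj (cdual_apply :: 'v dual complexification \<Rightarrow> _)"
  proof (rule injI)
    fix \<xi> \<eta> :: "'v dual complexification"
    assume eq: "cdual_apply \<xi> = cdual_apply \<eta>"
    have "dual_apply (re_part \<xi>) x = dual_apply (re_part \<eta>) x \<and>
          dual_apply (im_part \<xi>) x = dual_apply (im_part \<eta>) x" for x
      using fun_cong [OF eq, of "Cplx x 0"]
      by (simp add: cdual_apply_def complex_eq_iff linear_0 [OF linear_dual_apply])
    then show "\<xi> = \<eta>"
      by (simp add: complexification.expand dual_apply_inject [symmetric] fun_eq_iff)
  qed
next
  show "range cdual_apply =
      {\<phi> :: 'v complexification \<Rightarrow> complex. Vector_Spaces.linear cscale (*) \<phi>}"
  proof (intro equalityI subsetI)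
    fix \<phi> :: "'v complexification \<Rightarrow> complex"
    assume "\<phi> \<in> range cdual_apply"
    then obtain \<xi> where "\<phi> = cdual_apply \<xi>" by blast
    moreover have "Vector_Spaces.linear cscale (*) (cdual_apply \<xi>)"
    proof (unfold_locales)
      show "cdual_apply \<xi> (Z + W) = cdual_apply \<xi> Z + cdual_apply \<xi> W" for Z W
        by (simp add: cdual_apply_def plus_complexification_def complex_eq_iff
            linear_add [OF linear_dual_apply])
      show "cdual_apply \<xi> (cscale c Z) = c * cdual_apply \<xi> Z" for c Z
        by (simp add: cdual_apply_def cscale_def complex_eq_iff linear_add [OF linear_dual_apply]
            linear_diff [OF linear_dual_apply] linear_scale [OF linear_dual_apply] algebra_simps)
    qed
    ultimately show "\<phi> \<in> {\<phi>. Vector_Spaces.linear cscale (*) \<phi>}" by simp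
  next
    fix \<phi> :: "'v complexification \<Rightarrow> complex"
    assume "\<phi> \<in> {\<phi>. Vector_Spaces.linear cscale (*) \<phi>}"
    then interpret \<phi>: Vector_Spaces.linear cscale "(*)" \<phi> by simp
    have add: "\<phi> (Cplx (x + y) 0) = \<phi> (Cplx x 0) + \<phi> (Cplx y 0)" for x y
      using \<phi>.add [of "Cplx x 0" "Cplx y 0"] by (simp add: plus_complexification_def)
    have scale: "\<phi> (Cplx (r *\<^sub>R x) 0) = of_real r * \<phi> (Cplx x 0)" for r x
      using \<phi>.scale [of "of_real r" "Cplx x 0"] by (simp add: cscale_def)
    have re: "linear (\<lambda>x. Re (\<phi> (Cplx x 0)))"
      by (rule linearI) (simp_all add: add scale)
    have im: "linear (\<lambda>x. Im (\<phi> (Cplx x 0)))"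
      by (rule linearI) (simp_all add: add scale)
    have split: "\<phi> Z = \<phi> (Cplx (re_part Z) 0) + \<i> * \<phi> (Cplx (im_part Z) 0)" for Z
      using \<phi>.add [of "Cplx (re_part Z) 0" "cscale \<i> (Cplx (im_part Z) 0)"]
        \<phi>.scale [of \<i> "Cplx (im_part Z) 0"]
      by (simp add: plus_complexification_def cscale_def)
    have "\<phi> = cdual_apply (Cplx (Abs_dual (\<lambda>x. Re (\<phi> (Cplx x 0)))) (Abs_dual (\<lambda>x. Im (\<phi> (Cplx x 0)))))"
    proof
      fix Z
      show "\<phi> Z = cdual_apply (Cplx (Abs_dual (\<lambda>x. Re (\<phi> (Cplx x 0))))
                                    (Abs_dual (\<lambda>x. Im (\<phi> (Cplx x 0))))) Z"
        by (subst split) (simp add: cdual_apply_def Abs_dual_inverse re im complex_eq_iff)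
    qed
    then show "\<phi> \<in> range cdual_apply" by blast
  qed
qed

lemma complexification_real_points:
  fixes E :: "'v::real_vector complexification set"
  assumes "complexification.subspace E"
  shows "{w. re_part w \<in> real_points (E \<inter> cconj ` E) \<and> im_part w \<in> real_points (E \<inter> cconj ` E)}
       = E \<inter> cconj ` E"
proof -
  have cconj_image: "w \<in> cconj ` E \<longleftrightarrow> cconj w \<in> E" for w
  proof
    show "cconj w \<in> E \<Longrightarrow> w \<in> cconj ` E"
      by (rule image_eqI [of _ _ "cconj w"]) (simp_all add: cconj_def)
  qed (auto simp: cconj_def)
  have w: "cscale 1 (of_real_part (re_part w)) + cscale \<i> (of_real_part (im_part w)) = w"
    and cw: "cscale 1 (of_real_part (re_part w)) + cscale (- \<i>) (of_real_part (im_part w)) = cconj w"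
    and re: "cscale (1/2) w + cscale (1/2) (cconj w) = of_real_part (re_part w)"
    and im: "cscale (- \<i>/2) w + cscale (\<i>/2) (cconj w) = of_real_part (im_part w)"
    and real: "cconj (of_real_part x) = of_real_part x" for w :: "'v complexification" and x :: 'v
    by (simp_all add: cconj_def of_real_part_def cscale_def plus_complexification_def
        complexification.expand flip: scaleR_left_distrib)
  show ?thesis
  proof (intro set_eqI iffI)
    fix w
    assume "w \<in> {w. re_part w \<in> real_points (E \<inter> cconj ` E) \<and> im_part w \<in> real_points (E \<inter> cconj ` E)}"
    then have "of_real_part (re_part w) \<in> E" "of_real_part (im_part w) \<in> E"
      by (auto simp: real_points_def)
    then have "w \<in> E" "cconj w \<in> E"
      using w [of w] cw [of w] assms complexification.subspace_add complexification.subspace_scale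
      by metis+
    then show "w \<in> E \<inter> cconj ` E" by (simp add: cconj_image)
  next
    fix w
    assume "w \<in> E \<inter> cconj ` E"
    then have "w \<in> E" "cconj w \<in> E" by (simp_all add: cconj_image)
    then have "of_real_part (re_part w) \<in> E" "of_real_part (im_part w) \<in> E"
      using re [of w] im [of w] assms complexification.subspace_add complexification.subspace_scale
      by metis+
    then show "w \<in> {w. re_part w \<in> real_points (E \<inter> cconj ` E) \<and> im_part w \<in> real_points (E \<inter> cconj ` E)}"
      by (simp add: real_points_def cconj_image real)
  qed
qed


section \<open>Symmetric generalized complex structures\<close>

definition g_can :: "'v::real_vector \<times> 'v dual \<Rightarrow> 'v \<times> 'v dual \<Rightarrow> real" where
  "g_can u w = (dual_apply (snd u) (fst w) + dual_apply (snd w) (fst u)) / 2"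

definition symmetric_gcs :: "('v::real_vector \<times> 'v dual \<Rightarrow> 'v \<times> 'v dual) \<Rightarrow> bool" where
  "symmetric_gcs J \<longleftrightarrow>
     linear J \<and> (\<forall>u w. g_can (J u) w = g_can u (J w)) \<and> (\<forall>u. J (J u) = - u)"

definition holomorphic_space ::
    "('v::real_vector \<times> 'v dual \<Rightarrow> 'v \<times> 'v dual) \<Rightarrow> ('v \<times> 'v dual) complexification set" where
  "holomorphic_space J = {w. map_complexification J w = cscale \<i> w}"


section \<open>The subspaces \<open>L\<^sup>-(E, \<alpha>)\<close>\<close>

text \<open>Forms on \<open>E \<times> F\<close> are total functions; only their values on \<open>E \<times> F\<close> are relevant.\<close>

definition cbilinear_on ::
    "'a::real_vector complexification set \<Rightarrow> 'b::real_vector complexification set \<Rightarrow>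
     ('a complexification \<Rightarrow> 'b complexification \<Rightarrow> complex) \<Rightarrow> bool" where
  "cbilinear_on E F \<alpha> \<longleftrightarrow>
     (\<forall>X\<in>E. \<forall>X'\<in>E. \<forall>Y\<in>F. \<alpha> (X + X') Y = \<alpha> X Y + \<alpha> X' Y) \<and>
     (\<forall>X\<in>E. \<forall>Y\<in>F. \<forall>Y'\<in>F. \<alpha> X (Y + Y') = \<alpha> X Y + \<alpha> X Y') \<and>
     (\<forall>c. \<forall>X\<in>E. \<forall>Y\<in>F. \<alpha> (cscale c X) Y = c * \<alpha> X Y) \<and>
     (\<forall>c. \<forall>X\<in>E. \<forall>Y\<in>F. \<alpha> X (cscale c Y) = c * \<alpha> X Y)"

definition skew_hermitian_on ::
    "'v::real_vector complexification set \<Rightarrow>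
     ('v complexification \<Rightarrow> 'v complexification \<Rightarrow> complex) \<Rightarrow> bool" where
  "skew_hermitian_on E \<alpha> \<longleftrightarrow> (\<forall>X\<in>E. \<forall>Y\<in>E. \<alpha> X (cconj Y) + cnj (\<alpha> Y (cconj X)) = 0)"

definition nondegenerate_on :: "'v::real_vector set \<Rightarrow> ('v \<Rightarrow> 'v \<Rightarrow> real) \<Rightarrow> bool" where
  "nondegenerate_on D b \<longleftrightarrow>
     (\<forall>x\<in>D. (\<forall>y\<in>D. b x y = 0) \<longrightarrow> x = 0) \<and> (\<forall>y\<in>D. (\<forall>x\<in>D. b x y = 0) \<longrightarrow> y = 0)"

text \<open>An element \<open>w\<close> of the complexification of \<open>V \<oplus> V\<^sup>*\<close> is \<open>X + \<xi>\<close> with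
  \<open>X = map_complexification fst w\<close> and \<open>\<xi> = map_complexification snd w\<close>.\<close>

definition L_minus ::
    "'v::real_vector complexification set \<Rightarrow>
     ('v complexification \<Rightarrow> 'v complexification \<Rightarrow> complex) \<Rightarrow>
     ('v \<times> 'v dual) complexification set" where
  "L_minus E \<alpha> =
     {w. map_complexification fst w \<in> E \<and>
         (\<forall>Z \<in> cconj ` E. cdual_apply (map_complexification snd w) Z
                        = \<alpha> (map_complexification fst w) Z)}"

end

theory Submission
  imports Defs
begin

text \<open>The real part map sends the \<open>i\<close>-eigenspace of a complex structure isomorphically onto the
  underlying real space, and a complex subspace \<open>L\<close> with this property is such an eigenspace;
  symmetry of \<open>J\<close> says that \<open>L\<close> is isotropic for the Hermitian pairing \<open>g\<^sub>c\<^sub>a\<^sub>n(u, cconj w)\<close>.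
  Given \<open>J\<close>, isotropy makes \<open>\<xi>\<close> restricted to \<open>cconj ` E\<close> a function \<open>\<alpha>\<close> of \<open>X\<close> for
  \<open>X + \<xi> \<in> L\<close>, and maximality of \<open>L\<close> among isotropic spaces gives \<open>L = L_minus E \<alpha>\<close>. The link with
  condition (ii) is that a complex linear form on \<open>cconj ` E\<close> is the restriction of a real
  covector exactly when it is real on \<open>\<Delta>\<close>: hence the kernel of \<open>Im (\<alpha>|\<^sub>\<Delta>)\<close> corresponds to the real
  vectors of \<open>L\<close>, and solving \<open>Re (X + \<xi>) = (v, \<theta>)\<close> in \<open>L_minus E \<alpha>\<close> reduces to representing a
  functional on \<open>\<Delta>\<close> by \<open>Im (\<alpha>|\<^sub>\<Delta>)\<close>.\<close>

section \<open>Linear algebra\<close>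

lemma dual_separates:
  fixes x :: "'v::real_vector"
  assumes "\<And>f :: 'v dual. dual_apply f x = 0"
  shows "x = 0"
proof (rule ccontr)
  assume "x \<noteq> 0"
  then have "independent {x}" by simp
  then obtain f :: "'v \<Rightarrow> real" where "linear f" "f x = 1"
    using linear_independent_extend [of "{x}" "\<lambda>_. 1 :: real"] by (metis singletonI)
  then show False
    using assms [of "Abs_dual f"] by (simp add: Abs_dual_inverse)
qed

text \<open>This is where finite dimension enters: \<open>x \<mapsto> b x\<close> is injective from
  \<open>D\<close> to its dual, hence onto. Linearity is assumed on \<open>D\<close> alone, since
  forms on \<open>E\<close> are total functions whose values elsewhere are arbitrary.\<close>

lemma nondegenerate_represents:
  fixes D :: "'v::real_vector set" and b :: "'v \<Rightarrow> 'v \<Rightarrow> real"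
  assumes fin: "finite C" "D \<subseteq> span C" and D: "subspace D"
    and add1: "\<And>x x' y. x \<in> D \<Longrightarrow> x' \<in> D \<Longrightarrow> y \<in> D \<Longrightarrow> b (x + x') y = b x y + b x' y"
    and scale1: "\<And>r x y. x \<in> D \<Longrightarrow> y \<in> D \<Longrightarrow> b (r *\<^sub>R x) y = r * b x y"
    and add2: "\<And>x y y'. x \<in> D \<Longrightarrow> y \<in> D \<Longrightarrow> y' \<in> D \<Longrightarrow> b x (y + y') = b x y + b x y'"
    and scale2: "\<And>r x y. x \<in> D \<Longrightarrow> y \<in> D \<Longrightarrow> b x (r *\<^sub>R y) = r * b x y"
    and nondeg: "\<And>x. x \<in> D \<Longrightarrow> (\<And>y. y \<in> D \<Longrightarrow> b x y = 0) \<Longrightarrow> x = 0"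
    and fadd: "\<And>x y. x \<in> D \<Longrightarrow> y \<in> D \<Longrightarrow> f (x + y) = f x + f y"
    and fscale: "\<And>r x. x \<in> D \<Longrightarrow> f (r *\<^sub>R x) = r * f x"
  shows "\<exists>x\<in>D. \<forall>y\<in>D. b x y = f y"
proof -
  obtain B where B: "B \<subseteq> D" "independent B" "D \<subseteq> span B"
    by (metis basis_exists)
  have DB: "span B = D"
    using span_minimal [OF B(1) D] B(3) by (rule subset_antisym)
  have BD: "e \<in> D" if "e \<in> B" for e
    using that B(1) by blast
  have finB: "finite B"
    using independent_span_bound [OF fin(1) B(2)] B(1) fin(2) by blast
  \<comment> \<open>The basis \<open>B\<close> identifies the dual of \<open>D\<close> with
    \<open>D\<close> itself; \<open>T\<close> is then the map \<open>x \<mapsto> b x\<close> seen as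
    an endomorphism of \<open>D\<close>.\<close>
  define T where "T x = (\<Sum>e\<in>B. b x e *\<^sub>R e)" for x
  \<comment> \<open>\<open>T\<close> behaves linearly on \<open>D\<close> only, so it is replaced by
    a globally linear map that agrees with it on \<open>span B = D\<close>.\<close>
  obtain T' where T': "linear T'" "\<And>e. e \<in> B \<Longrightarrow> T' e = T e"
    using linear_independent_extend [OF B(2), of T] by blast
  have b0: "b 0 y = 0" "b y 0 = 0" if "y \<in> D" for y
    using scale1 [of 0 y 0] scale2 [of y 0 0] that D by (simp_all add: subspace_0)
  have f0: "f 0 = 0"
    using fscale [of 0 0] D by (simp add: subspace_0)
  have TT': "T' x = T x \<and> x \<in> D" if "x \<in> span B" for x
    using that
  proof (induction rule: span_induct_alt)
    case base
    have "T 0 = 0" unfolding T_def by (rule sum.neutral) (simp add: b0 BD)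
    then show ?case using T' D by (simp add: linear_0 subspace_0)
  next
    case (step c x y)
    then have D': "x \<in> D" "c *\<^sub>R x \<in> D" "y \<in> D" "T' x = T x"
      using BD D T' by (simp_all add: subspace_scale)
    have "T (c *\<^sub>R x + y) = (\<Sum>e\<in>B. c *\<^sub>R (b x e *\<^sub>R e) + b y e *\<^sub>R e)"
      unfolding T_def
      by (rule sum.cong) (simp_all add: D' BD add1 scale1 scaleR_left_distrib)
    also have "\<dots> = c *\<^sub>R T x + T y"
      by (simp add: T_def sum.distrib scaleR_sum_right)
    finally show ?case
      using step D' D T' by (simp add: linear_add linear_scale subspace_add)
  qed
  have zero: "x = 0" if x: "x \<in> D" and e: "\<And>e. e \<in> B \<Longrightarrow> b x e = 0" for x
  proof (rule nondeg [OF x])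
    fix y assume "y \<in> D"
    then have "y \<in> span B" by (simp add: DB)
    then have "y \<in> D \<and> b x y = 0"
    proof (induction rule: span_induct_alt)
      case base
      then show ?case using x D by (simp add: b0 subspace_0)
    next
      case (step c z y)
      then show ?case
        using x D BD e by (simp add: subspace_add subspace_scale add2 scale2)
    qed
    then show "b x y = 0" by simp
  qed
  have coeff: "\<forall>e\<in>B. c e = 0" if "(\<Sum>e\<in>B. c e *\<^sub>R e) = 0" for c :: "'v \<Rightarrow> real"
    using independentD [OF B(2) finB subset_refl that] by blast
  have inj: "inj_on T' (span B)"
  proof (subst linear_injective_on_subspace_0 [OF T'(1)], simp, intro ballI impI)
    fix x assume x: "x \<in> span B" "T' x = 0"
    then have "\<forall>e\<in>B. b x e = 0" using TT' coeff unfolding T_def by metis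
    then show "x = 0" using zero x DB by blast
  qed
  have ind: "independent (T' ` B)"
    by (rule linear_independent_injective_image [OF T'(1) B(2) inj])
  have sub: "T' ` B \<subseteq> span B"
  proof (rule image_subsetI)
    fix e assume "e \<in> B"
    then have "T' e = (\<Sum>e'\<in>B. b e e' *\<^sub>R e')"
      by (simp add: T' T_def)
    then show "T' e \<in> span B"
      by (simp add: span_sum span_scale span_base)
  qed
  have card: "card (T' ` B) = card B"
    using inj by (meson card_image inj_on_subset span_superset)
  \<comment> \<open>Injective implies onto, by counting: a basis vector outside
    \<open>span (T'\<close> B)\<open>would enlarge\<close>T' \<open>B\<close> to an independent set
    with more than \<open>card B\<close> elements inside \<open>span B\<close>.\<close>
  have "B \<subseteq> span (T' ` B)"
  proof
    fix e assume e: "e \<in> B"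
    show "e \<in> span (T' ` B)"
    proof (rule ccontr)
      assume not: "e \<notin> span (T' ` B)"
      then have "independent (insert e (T' ` B))"
        using ind independent_insertI by blast
      moreover have "insert e (T' ` B) \<subseteq> span B"
        using sub e span_base by blast
      ultimately have "card (insert e (T' ` B)) \<le> card B"
        using independent_span_bound [OF finB] by blast
      then show False
        using not finB card span_base [of e "T' ` B"] by (auto simp: card_insert_if split: if_splits)
    qed
  qed
  then have "span B \<subseteq> T' ` span B"
    using T' by (metis linear_span_image span_minimal subspace_span)
  moreover have "(\<Sum>e\<in>B. f e *\<^sub>R e) \<in> span B"
    by (intro span_sum span_scale span_base)
  ultimately have "(\<Sum>e\<in>B. f e *\<^sub>R e) \<in> T' ` span B"
    by (rule subsetD)
  then obtain x where x: "x \<in> span B" "T' x = (\<Sum>e\<in>B. f e *\<^sub>R e)"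
    by (rule imageE) simp
  then have "(\<Sum>e\<in>B. (b x e - f e) *\<^sub>R e) = 0"
    using TT' by (auto simp: T_def scaleR_diff_left sum_subtractf)
  then have e: "b x e = f e" if "e \<in> B" for e
    using coeff that by fastforce
  show ?thesis
  proof (intro bexI ballI)
    show xD: "x \<in> D" using x DB by simp
    fix y assume "y \<in> D"
    then have "y \<in> span B" by (simp add: DB)
    then have "y \<in> D \<and> b x y = f y"
    proof (induction rule: span_induct_alt)
      case base
      then show ?case using xD D by (simp add: b0 f0 subspace_0)
    next
      case (step c z y)
      then show ?case
        using xD D BD e by (simp add: subspace_add subspace_scale add2 scale2 fadd fscale)
    qed
    then show "b x y = f y" by simp
  qed
qed

section \<open>Complexifications\<close>

lemma complexification_parts [simp]:
  "re_part 0 = 0" "im_part 0 = 0"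
  "re_part (w + z) = re_part w + re_part z" "im_part (w + z) = im_part w + im_part z"
  "re_part (- w) = - re_part w" "im_part (- w) = - im_part w"
  "re_part (w - z) = re_part w - re_part z" "im_part (w - z) = im_part w - im_part z"
  "re_part (cconj w) = re_part w" "im_part (cconj w) = - im_part w"
  "re_part (of_real_part x) = x" "im_part (of_real_part x) = 0"
  by (simp_all add: zero_complexification_def plus_complexification_def
      uminus_complexification_def minus_complexification_def cconj_def of_real_part_def)

lemma cscale_parts [simp]:
  "re_part (cscale c w) = Re c *\<^sub>R re_part w - Im c *\<^sub>R im_part w"
  "im_part (cscale c w) = Re c *\<^sub>R im_part w + Im c *\<^sub>R re_part w"
  by (simp_all add: cscale_def)

lemma complexification_eq_iff: "w = z \<longleftrightarrow> re_part w = re_part z \<and> im_part w = im_part z"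
  by (auto intro: complexification.expand)

lemma cconj_cconj [simp]: "cconj (cconj w) = w"
  by (simp add: complexification_eq_iff)

lemma cconj_of_real_part [simp]: "cconj (of_real_part x) = of_real_part x"
  by (simp add: complexification_eq_iff)

lemma mem_cconj_image_iff: "w \<in> cconj ` E \<longleftrightarrow> cconj w \<in> E"
  by (metis cconj_cconj image_iff)

lemma subspace_cconj_image:
  assumes "complexification.subspace E"
  shows "complexification.subspace (cconj ` E)"
proof (rule complexification.subspaceI)
  show "0 \<in> cconj ` E"
    using complexification.subspace_0 [OF assms]
    by (metis complexification_eq_iff complexification_parts(1,2,9,10) imageI minus_zero)
  fix x y assume xy: "x \<in> cconj ` E" "y \<in> cconj ` E"
  have "cconj (x + y) = cconj x + cconj y"
    by (simp add: complexification_eq_iff)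
  then show "x + y \<in> cconj ` E"
    using xy complexification.subspace_add [OF assms] by (simp add: mem_cconj_image_iff)
next
  fix c x assume x: "x \<in> cconj ` E"
  have "cconj (cscale c x) = cscale (cnj c) (cconj x)"
    by (simp add: complexification_eq_iff)
  then show "cscale c x \<in> cconj ` E"
    using x complexification.subspace_scale [OF assms] by (simp add: mem_cconj_image_iff)
qed

lemma mem_real_points_iff: "x \<in> real_points (E \<inter> cconj ` E) \<longleftrightarrow> of_real_part x \<in> E"
  by (simp add: real_points_def mem_cconj_image_iff)

lemma subspace_real_points:
  assumes "complexification.subspace S"
  shows "subspace (real_points S)"
proof (rule subspaceI)
  have "of_real_part 0 = (0 :: 'a complexification)"
    by (simp add: complexification_eq_iff)
  then show "0 \<in> real_points S"
    using complexification.subspace_0 [OF assms] by (simp add: real_points_def)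
  fix x y assume "x \<in> real_points S" "y \<in> real_points S"
  moreover have "of_real_part (x + y) = of_real_part x + of_real_part y"
    by (simp add: complexification_eq_iff)
  ultimately show "x + y \<in> real_points S"
    using complexification.subspace_add [OF assms] by (simp add: real_points_def)
next
  fix r x assume "x \<in> real_points S"
  moreover have "of_real_part (r *\<^sub>R x) = cscale (of_real r) (of_real_part x)"
    by (simp add: complexification_eq_iff)
  ultimately show "r *\<^sub>R x \<in> real_points S"
    using complexification.subspace_scale [OF assms] by (simp add: real_points_def)
qed

text \<open>Conjugation keeps real parts, so in a decomposition \<open>v = p + q\<close> the summand
  \<open>q\<close> may be replaced by \<open>cconj q\<close>, which lies in \<open>E\<close>. The
  hypothesis on the sum is exploited later in this form.\<close>

lemma re_part_onto:
  assumes E: "complexification.subspace E" and sum: "E + cconj ` E = UNIV"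
  shows "\<exists>q\<in>E. re_part q = v"
proof -
  obtain p q where pq: "p \<in> E" "q \<in> cconj ` E" "of_real_part v = p + q"
    using sum by (metis UNIV_I set_plus_elim)
  show ?thesis
  proof
    show "p + cconj q \<in> E"
      using pq complexification.subspace_add [OF E] by (simp add: mem_cconj_image_iff)
    show "re_part (p + cconj q) = v"
      using arg_cong [OF pq(3), of re_part] by simp
  qed
qed

section \<open>Complex-linear functionals and real covectors\<close>

lemmas dual_apply_linear [simp] =
  linear_0 [OF linear_dual_apply] linear_add [OF linear_dual_apply]
  linear_diff [OF linear_dual_apply] linear_neg [OF linear_dual_apply]
  linear_scale [OF linear_dual_apply]
  zero_dual.rep_eq plus_dual.rep_eq minus_dual.rep_eq uminus_dual.rep_eq scaleR_dual.rep_eq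

lemma Re_Im_cdual_apply [simp]:
  "Re (cdual_apply \<xi> Z) = dual_apply (re_part \<xi>) (re_part Z) - dual_apply (im_part \<xi>) (im_part Z)"
  "Im (cdual_apply \<xi> Z) = dual_apply (re_part \<xi>) (im_part Z) + dual_apply (im_part \<xi>) (re_part Z)"
  by (simp_all add: cdual_apply_def)

lemma cdual_apply_bilinear:
  "cdual_apply \<xi> (Z + W) = cdual_apply \<xi> Z + cdual_apply \<xi> W"
  "cdual_apply \<xi> (cscale c Z) = c * cdual_apply \<xi> Z"
  "cdual_apply (\<xi> + \<eta>) Z = cdual_apply \<xi> Z + cdual_apply \<eta> Z"
  "cdual_apply (cscale c \<xi>) Z = c * cdual_apply \<xi> Z"
  by (simp_all add: complex_eq_iff algebra_simps)

text \<open>A real covector \<open>\<zeta>\<close> has real part \<open>\<zeta> (re_part q)\<close>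
  at \<open>q\<close>, which forces \<open>\<zeta> v = Re (\<phi> q)\<close> for any
  \<open>q\<close> in \<open>F\<close> over \<open>v\<close>. Two choices of \<open>q\<close> differ
  by \<open>\<i>\<close> times a real vector of \<open>F\<close>, where \<open>\<phi>\<close> is
  real, so \<open>Re (\<phi> q)\<close> does not change.\<close>

lemma real_covector_extension:
  fixes F :: "'v::real_vector complexification set" and \<phi> :: "'v complexification \<Rightarrow> complex"
  assumes F: "complexification.subspace F" and onto: "\<And>v. \<exists>q\<in>F. re_part q = v"
    and add: "\<And>p q. p \<in> F \<Longrightarrow> q \<in> F \<Longrightarrow> \<phi> (p + q) = \<phi> p + \<phi> q"
    and scale: "\<And>c q. q \<in> F \<Longrightarrow> \<phi> (cscale c q) = c * \<phi> q"
    and real: "\<And>y. of_real_part y \<in> F \<Longrightarrow> Im (\<phi> (of_real_part y)) = 0"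
  shows "\<exists>\<zeta>. \<forall>q\<in>F. cdual_apply (of_real_part \<zeta>) q = \<phi> q"
proof -
  obtain Q where Q: "\<And>v. Q v \<in> F" "\<And>v. re_part (Q v) = v"
    using onto by metis
  have key: "Re (\<phi> (Q (re_part q))) = Re (\<phi> q)" if q: "q \<in> F" for q
  proof -
    let ?y = "im_part (q - Q (re_part q))"
    have "of_real_part ?y = cscale (- \<i>) (q - Q (re_part q))"
      by (simp add: complexification_eq_iff Q)
    then have y: "of_real_part ?y \<in> F"
      using complexification.subspace_scale [OF F] complexification.subspace_diff [OF F] q Q(1)
      by metis
    have "q = Q (re_part q) + cscale \<i> (of_real_part ?y)"
      by (simp add: complexification_eq_iff Q)
    then have "\<phi> q = \<phi> (Q (re_part q)) + \<i> * \<phi> (of_real_part ?y)"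
      using add scale y Q(1) complexification.subspace_scale [OF F] by metis
    then show ?thesis using real [OF y] by simp
  qed
  define \<zeta> where "\<zeta> = Abs_dual (\<lambda>v. Re (\<phi> (Q v)))"
  have "linear (\<lambda>v. Re (\<phi> (Q v)))"
  proof (rule linearI)
    fix v v'
    have "Q v + Q v' \<in> F" using Q(1) complexification.subspace_add [OF F] by blast
    from key [OF this] show "Re (\<phi> (Q (v + v'))) = Re (\<phi> (Q v)) + Re (\<phi> (Q v'))"
      by (simp add: Q add)
  next
    fix r v
    have "cscale (of_real r) (Q v) \<in> F" using Q(1) complexification.subspace_scale [OF F] by blast
    from key [OF this] show "Re (\<phi> (Q (r *\<^sub>R v))) = r *\<^sub>R Re (\<phi> (Q v))"
      by (simp add: Q scale)
  qed
  then have \<zeta>: "dual_apply \<zeta> v = Re (\<phi> (Q v))" for v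
    by (simp add: \<zeta>_def Abs_dual_inverse)
  show ?thesis
  proof (intro exI ballI)
    fix q assume q: "q \<in> F"
    \<comment> \<open>The real part of a complex-linear form determines it: the imaginary part of
      \<open>\<phi> q\<close> is the real part of \<open>\<phi>\<close> at
      \<open>- \<i> q\<close>.\<close>
    then have "cscale (- \<i>) q \<in> F" using complexification.subspace_scale [OF F] by blast
    from key [OF this] key [OF q] scale [OF q, of "- \<i>"] show "cdual_apply (of_real_part \<zeta>) q = \<phi> q"
      by (simp add: complex_eq_iff \<zeta>)
  qed
qed

section \<open>Symmetric generalized complex structures\<close>

abbreviation vec_part :: "('v::real_vector \<times> 'v dual) complexification \<Rightarrow> 'v complexification" where
  "vec_part \<equiv> map_complexification fst"

abbreviation form_part :: "('v::real_vector \<times> 'v dual) complexification \<Rightarrow> 'v dual complexification" where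
  "form_part \<equiv> map_complexification snd"

lemma map_complexification_parts [simp]:
  "re_part (map_complexification f w) = f (re_part w)"
  "im_part (map_complexification f w) = f (im_part w)"
  by (simp_all add: complexification.map_sel)

lemma cbilinear_onD:
  assumes "cbilinear_on E F \<alpha>"
  shows "\<And>X X' Y. X \<in> E \<Longrightarrow> X' \<in> E \<Longrightarrow> Y \<in> F \<Longrightarrow> \<alpha> (X + X') Y = \<alpha> X Y + \<alpha> X' Y"
    and "\<And>X Y Y'. X \<in> E \<Longrightarrow> Y \<in> F \<Longrightarrow> Y' \<in> F \<Longrightarrow> \<alpha> X (Y + Y') = \<alpha> X Y + \<alpha> X Y'"
    and "\<And>c X Y. X \<in> E \<Longrightarrow> Y \<in> F \<Longrightarrow> \<alpha> (cscale c X) Y = c * \<alpha> X Y"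
    and "\<And>c X Y. X \<in> E \<Longrightarrow> Y \<in> F \<Longrightarrow> \<alpha> X (cscale c Y) = c * \<alpha> X Y"
  using assms by (simp_all add: cbilinear_on_def)

lemma L_minus_iff:
  "w \<in> L_minus E \<alpha> \<longleftrightarrow> vec_part w \<in> E \<and>
     (\<forall>Z. Z \<in> cconj ` E \<longrightarrow> cdual_apply (form_part w) Z = \<alpha> (vec_part w) Z)"
  unfolding L_minus_def by blast

text \<open>Twice the Hermitian pairing of \<open>g_can\<close>.\<close>
definition herm ::
    "('v::real_vector \<times> 'v dual) complexification \<Rightarrow> ('v \<times> 'v dual) complexification \<Rightarrow> complex" where
  "herm w z = cdual_apply (form_part w) (cconj (vec_part z))
            + cnj (cdual_apply (form_part z) (cconj (vec_part w)))"

lemma Re_Im_herm: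
  "Re (herm w z) = 2 * (g_can (re_part w) (re_part z) + g_can (im_part w) (im_part z))"
  "Im (herm w z) = 2 * (g_can (im_part w) (re_part z) - g_can (re_part w) (im_part z))"
  by (simp_all add: herm_def g_can_def add_divide_distrib)

lemma g_can_linear [simp]:
  "g_can (u + u') w = g_can u w + g_can u' w" "g_can (- u) w = - g_can u w"
  "g_can w (- u) = - g_can w u" "g_can (u - u') w = g_can u w - g_can u' w"
  by (simp_all add: g_can_def field_simps)

text \<open>Testing against \<open>(0, f)\<close> and against \<open>(x, 0)\<close> isolates the two
  components of \<open>a\<close>.\<close>

lemma g_can_nondegenerate:
  fixes a :: "'v::real_vector \<times> 'v dual"
  assumes "\<And>u. g_can a u = 0"
  shows "a = 0"
proof -
  have "fst a = 0"
    by (rule dual_separates) (use assms [of "(0, _)"] in \<open>simp add: g_can_def\<close>)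
  moreover have "dual_apply (snd a) x = 0" for x
    using assms [of "(x, 0)"] by (simp add: g_can_def)
  then have "snd a = 0"
    by (simp add: dual_apply_inject [symmetric] fun_eq_iff)
  ultimately show ?thesis by (simp add: prod_eq_iff)
qed

text \<open>The eigenvalue equation splits into two real equations, and
  \<open>J\<^sup>2 = - Id\<close> makes one of them imply the other. The eigenspace is thus the
  graph of \<open>- J\<close>.\<close>

lemma mem_holomorphic_space_iff:
  assumes "symmetric_gcs J"
  shows "w \<in> holomorphic_space J \<longleftrightarrow> im_part w = - J (re_part w)"
proof -
  have "linear J" and "\<And>u. J (J u) = - u"
    using assms unfolding symmetric_gcs_def by blast+
  then have "J (im_part w) = re_part w" if "im_part w = - J (re_part w)"
    using that by (simp only: linear_neg minus_minus)
  then show ?thesis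
    by (auto simp: holomorphic_space_def complexification_eq_iff)
qed

text \<open>The eigenspace is its own orthogonal space for \<open>herm\<close>. Isotropy is the
  symmetry of \<open>J\<close> together with \<open>J\<^sup>2 = - Id\<close>; for the converse,
  pairing \<open>w\<close> with the graph point over \<open>u\<close> has imaginary part
  \<open>2 * g_can (im_part w + J (re_part w)) u\<close>.\<close>

lemma herm_holomorphic_space:
  assumes J: "symmetric_gcs J"
  shows "w \<in> holomorphic_space J \<longleftrightarrow> (\<forall>z \<in> holomorphic_space J. herm w z = 0)"
proof (intro iffI ballI)
  have sym: "g_can (J u) v = g_can u (J v)" and sq: "J (J u) = - u" for u v
    using J unfolding symmetric_gcs_def by blast+
  show "herm w z = 0" if "w \<in> holomorphic_space J" "z \<in> holomorphic_space J" for z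
    using that by (simp add: mem_holomorphic_space_iff [OF J] complex_eq_iff Re_Im_herm sym sq)
  assume orth: "\<forall>z \<in> holomorphic_space J. herm w z = 0"
  have "im_part w + J (re_part w) = 0"
  proof (rule g_can_nondegenerate)
    fix u
    have "Cplx u (- J u) \<in> holomorphic_space J"
      by (simp add: mem_holomorphic_space_iff [OF J])
    with orth have "Im (herm w (Cplx u (- J u))) = 0" by simp
    then show "g_can (im_part w + J (re_part w)) u = 0"
      by (simp add: Re_Im_herm sym)
  qed
  then show "w \<in> holomorphic_space J"
    by (simp add: mem_holomorphic_space_iff [OF J] eq_neg_iff_add_eq_0)
qed

text \<open>Bijectivity of the real part makes \<open>L\<close> a graph, and \<open>J\<close> is
  minus the map with this graph. Complex linearity of \<open>L\<close> yields linearity and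
  \<open>J\<^sup>2 = - Id\<close>; isotropy yields symmetry.\<close>

lemma symmetric_gcs_of_real_part_bij:
  assumes L: "complexification.subspace L"
    and onto: "\<And>u. \<exists>w\<in>L. re_part w = u"
    and inj: "\<And>w. w \<in> L \<Longrightarrow> re_part w = 0 \<Longrightarrow> w = 0"
    and isotropic: "\<And>w z. w \<in> L \<Longrightarrow> z \<in> L \<Longrightarrow> herm w z = 0"
  shows "\<exists>J. symmetric_gcs J \<and> L = holomorphic_space J"
proof -
  obtain W where W: "\<And>u. W u \<in> L" "\<And>u. re_part (W u) = u"
    using onto by metis
  have W_eq: "W (re_part w) = w" if "w \<in> L" for w
    using inj [of "W (re_part w) - w"] complexification.subspace_diff [OF L] W that by simp
  define J where "J u = - im_part (W u)" for u
  have "linear J"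
  proof (rule linearI)
    fix u v
    have "W u + W v \<in> L" using W(1) complexification.subspace_add [OF L] by blast
    from W_eq [OF this] show "J (u + v) = J u + J v" by (simp add: J_def W)
  next
    fix r u
    have "cscale (of_real r) (W u) \<in> L" using W(1) complexification.subspace_scale [OF L] by blast
    from W_eq [OF this] show "J (r *\<^sub>R u) = r *\<^sub>R J u" by (simp add: J_def W)
  qed
  moreover have "g_can (J u) v = g_can u (J v)" for u v
    using arg_cong [OF isotropic [OF W(1) W(1)], of Im u v] by (simp add: Re_Im_herm J_def W)
  moreover have "J (J u) = - u" for u
  proof -
    \<comment> \<open>Multiplication by \<open>\<i>\<close> turns \<open>u - \<i> J u\<close> into
      \<open>J u + \<i> u\<close>, which must be the graph point over \<open>J u\<close>.\<close>
    have "cscale \<i> (W u) \<in> L" using W(1) complexification.subspace_scale [OF L] by blast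
    from W_eq [OF this] show ?thesis by (simp add: J_def W)
  qed
  ultimately have J: "symmetric_gcs J" by (simp add: symmetric_gcs_def)
  have "w \<in> L \<longleftrightarrow> im_part w = - J (re_part w)" for w
  proof
    show "im_part w = - J (re_part w)" if "w \<in> L"
      using W_eq [OF that] by (simp add: J_def)
    assume "im_part w = - J (re_part w)"
    then have "W (re_part w) = w"
      by (simp add: J_def W complexification_eq_iff)
    then show "w \<in> L"
      using W(1) by metis
  qed
  then have "L = holomorphic_space J"
    by (simp add: set_eq_iff mem_holomorphic_space_iff [OF J])
  with J show ?thesis by blast
qed

section \<open>The correspondence\<close>

lemma holomorphic_space_imp_L_minus:
  fixes L :: "('v::real_vector \<times> 'v dual) complexification set"
  assumes L: "complexification.subspace L" and J: "symmetric_gcs J" and LJ: "L = holomorphic_space J"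
  shows "\<exists>E \<alpha>. complexification.subspace E \<and> E + cconj ` E = UNIV \<and>
       cbilinear_on E (cconj ` E) \<alpha> \<and>
       skew_hermitian_on E \<alpha> \<and>
       nondegenerate_on (real_points (E \<inter> cconj ` E))
         (\<lambda>x y. Im (\<alpha> (of_real_part x) (of_real_part y))) \<and>
       L = L_minus E \<alpha>"
proof -
  define E where "E = vec_part ` L"
  define \<alpha> where "\<alpha> X = cdual_apply (form_part (SOME w. w \<in> L \<and> vec_part w = X))" for X
  have vec_add: "vec_part (w + z) = vec_part w + vec_part z"
    and vec_scale: "vec_part (cscale c w) = cscale c (vec_part w)"
    and form_add: "form_part (w + z) = form_part w + form_part z"
    and form_scale: "form_part (cscale c w) = cscale c (form_part w)"
    for w z :: "('v \<times> 'v dual) complexification" and c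
    by (simp_all add: complexification_eq_iff)
  have E: "complexification.subspace E"
    unfolding E_def
  proof (rule complexification.subspaceI)
    show "0 \<in> vec_part ` L"
      by (rule image_eqI [of _ _ 0])
        (simp_all add: complexification_eq_iff complexification.subspace_0 [OF L])
  qed (use complexification.subspace_add [OF L] complexification.subspace_scale [OF L]
      vec_add [symmetric] vec_scale [symmetric] in auto)
  have isotropic: "herm w z = 0" if "w \<in> L" "z \<in> L" for w z
    using herm_holomorphic_space [OF J, of w] that unfolding LJ by blast
  have maximal: "w \<in> L" if "\<And>z. z \<in> L \<Longrightarrow> herm w z = 0" for w
    using herm_holomorphic_space [OF J, of w] that unfolding LJ by blast
  have \<alpha>: "\<alpha> (vec_part w) Z = cdual_apply (form_part w) Z"
    if w: "w \<in> L" and Z: "Z \<in> cconj ` E" for w Z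
  proof -
    obtain z where z: "z \<in> L" "Z = cconj (vec_part z)"
      using Z by (auto simp: E_def)
    define w' where "w' = (SOME w'. w' \<in> L \<and> vec_part w' = vec_part w)"
    have w': "w' \<in> L \<and> vec_part w' = vec_part w"
      unfolding w'_def by (rule someI) (use w in blast)
    then have "herm w' z = 0" "herm w z = 0"
      using isotropic w z(1) by blast+
    with w' show ?thesis
      unfolding herm_def \<alpha>_def w'_def [symmetric] z(2) by (metis add_right_cancel)
  qed
  have sum: "E + cconj ` E = UNIV"
  proof -
    have half: "\<exists>w\<in>L. re_part w = u" for u
      by (rule bexI [of _ "Cplx u (- J u)"]) (simp_all add: LJ mem_holomorphic_space_iff [OF J])
    have "Z \<in> E + cconj ` E" for Z
    proof -
      obtain w1 w2 where w: "w1 \<in> L" "w2 \<in> L" "re_part w1 = (re_part Z, 0)" "re_part w2 = (im_part Z, 0)"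
        using half by meson
      let ?p = "\<lambda>c. cscale (1/2) (vec_part w1) + cscale (c/2) (vec_part w2)"
      have inE: "?p c \<in> E" for c
        using w E unfolding E_def
        by (intro complexification.subspace_add complexification.subspace_scale) auto
      \<comment> \<open>With \<open>a\<close> and \<open>b\<close> the vector parts of
        \<open>w1\<close> and \<open>w2\<close>, the sum is
        \<open>(a + cconj a)/2 + \<i> (b + cconj b)/2\<close>, that is,
        \<open>re_part Z + \<i> im_part Z\<close>.\<close>
      have "Z = ?p \<i> + cconj (?p (- \<i>))"
        using w by (simp add: complexification_eq_iff flip: scaleR_left_distrib)
      then show ?thesis
        using inE by (metis imageI set_plus_intro)
    qed
    then show ?thesis by auto
  qed
  have bil: "cbilinear_on E (cconj ` E) \<alpha>"
    unfolding cbilinear_on_def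
  proof (intro conjI allI ballI)
    note F = subspace_cconj_image [OF E]
    fix X Y assume X: "X \<in> E" and Y: "Y \<in> cconj ` E"
    then obtain w where w: "w \<in> L" "X = vec_part w" by (auto simp: E_def)
    show "\<alpha> (X + X') Y = \<alpha> X Y + \<alpha> X' Y" if X': "X' \<in> E" for X'
    proof -
      obtain w' where w': "w' \<in> L" "X' = vec_part w'" using X' by (auto simp: E_def)
      then have "w + w' \<in> L" using w complexification.subspace_add [OF L] by blast
      from \<alpha> [OF this Y] \<alpha> [OF w(1) Y] \<alpha> [OF w'(1) Y] show ?thesis
        by (simp add: w(2) w'(2) vec_add form_add cdual_apply_bilinear)
    qed
    show "\<alpha> X (Y + Y') = \<alpha> X Y + \<alpha> X Y'" if "Y' \<in> cconj ` E" for Y'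
    proof -
      have "Y + Y' \<in> cconj ` E" using Y that complexification.subspace_add [OF F] by blast
      from \<alpha> [OF w(1) this] \<alpha> [OF w(1) Y] \<alpha> [OF w(1) that] show ?thesis
        by (simp add: w(2) cdual_apply_bilinear)
    qed
    show "\<alpha> (cscale c X) Y = c * \<alpha> X Y" for c
    proof -
      have "cscale c w \<in> L" using w complexification.subspace_scale [OF L] by blast
      from \<alpha> [OF this Y] \<alpha> [OF w(1) Y] show ?thesis
        by (simp add: w(2) vec_scale form_scale cdual_apply_bilinear)
    qed
    show "\<alpha> X (cscale c Y) = c * \<alpha> X Y" for c
    proof -
      have "cscale c Y \<in> cconj ` E" using Y complexification.subspace_scale [OF F] by blast
      from \<alpha> [OF w(1) this] \<alpha> [OF w(1) Y] show ?thesis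
        by (simp add: w(2) cdual_apply_bilinear)
    qed
  qed
  have skew: "skew_hermitian_on E \<alpha>"
    unfolding skew_hermitian_on_def
  proof (intro ballI)
    fix X Y assume XY: "X \<in> E" "Y \<in> E"
    then obtain w z where wz: "w \<in> L" "z \<in> L" "X = vec_part w" "Y = vec_part z"
      unfolding E_def by blast
    then have "herm w z = 0" using isotropic by blast
    then show "\<alpha> X (cconj Y) + cnj (\<alpha> Y (cconj X)) = 0"
      using \<alpha> [OF wz(1) imageI [OF XY(2)]] \<alpha> [OF wz(2) imageI [OF XY(1)]] wz(3,4)
      by (simp add: herm_def)
  qed
  have L_minus: "L = L_minus E \<alpha>"
  proof (intro equalityI subsetI)
    show "w \<in> L_minus E \<alpha>" if "w \<in> L" for w
      unfolding L_minus_iff using \<alpha> [OF that] that E_def by (metis imageI)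
  next
    fix w assume w: "w \<in> L_minus E \<alpha>"
    then have "vec_part w \<in> E" unfolding L_minus_iff by blast
    then obtain w' where w': "w' \<in> L" "vec_part w' = vec_part w"
      unfolding E_def by (metis imageE)
    show "w \<in> L"
    proof (rule maximal)
      fix z assume z: "z \<in> L"
      then have Z: "cconj (vec_part z) \<in> cconj ` E" unfolding E_def by blast
      then have "cdual_apply (form_part w) (cconj (vec_part z)) = \<alpha> (vec_part w) (cconj (vec_part z))"
        using w unfolding L_minus_iff by blast
      then have "herm w z = herm w' z"
        using \<alpha> [OF w'(1) Z] w'(2) by (simp add: herm_def)
      then show "herm w z = 0" using isotropic [OF w'(1) z] by simp
    qed
  qed
  have F: "complexification.subspace (cconj ` E)"
    by (rule subspace_cconj_image [OF E])
  have onto: "\<exists>q\<in>cconj ` E. re_part q = v" for v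
    using re_part_onto [OF E sum, of v] by auto
  \<comment> \<open>If \<open>x\<close> is in the kernel, \<open>\<alpha>(x, -)\<close> is real on
    \<open>\<Delta>\<close> and so extends to a real covector \<open>\<zeta>\<close>. The real
    vector \<open>(x, \<zeta>)\<close> then lies in the graph of \<open>- J\<close>, so the
    invertible \<open>J\<close> kills it.\<close>
  have left: "x = 0"
    if x: "of_real_part x \<in> E"
      and 0: "\<And>y. of_real_part y \<in> E \<Longrightarrow> Im (\<alpha> (of_real_part x) (of_real_part y)) = 0" for x
  proof -
    have "\<exists>\<zeta>. \<forall>q\<in>cconj ` E. cdual_apply (of_real_part \<zeta>) q = \<alpha> (of_real_part x) q"
    proof (rule real_covector_extension [OF F onto])
      show "Im (\<alpha> (of_real_part x) (of_real_part y)) = 0" if "of_real_part y \<in> cconj ` E" for y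
        using 0 that by (simp add: mem_cconj_image_iff)
    qed (rule cbilinear_onD(2,4) [OF bil x], assumption+)+
    then obtain \<zeta> where \<zeta>: "\<forall>q\<in>cconj ` E. cdual_apply (of_real_part \<zeta>) q = \<alpha> (of_real_part x) q"
      by (rule exE)
    have "vec_part (of_real_part (x, \<zeta>)) = of_real_part x" "form_part (of_real_part (x, \<zeta>)) = of_real_part \<zeta>"
      by (simp_all add: complexification_eq_iff)
    then have "of_real_part (x, \<zeta>) \<in> L"
      unfolding L_minus L_minus_def using x \<zeta> by simp
    then have "J (x, \<zeta>) = 0"
      using mem_holomorphic_space_iff [OF J] by (simp add: LJ)
    moreover have "linear J" "J (J (x, \<zeta>)) = - (x, \<zeta>)"
      using J unfolding symmetric_gcs_def by blast+
    ultimately have "(x, \<zeta>) = 0" by (metis linear_0 neg_equal_0_iff_equal)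
    then show "x = 0" by (simp add: prod_eq_iff)
  qed
  \<comment> \<open>On real vectors the skew-Hermitian condition makes the imaginary part symmetric,
    so the left kernel decides non-degeneracy on both sides.\<close>
  have symm: "Im (\<alpha> (of_real_part x) (of_real_part y)) = Im (\<alpha> (of_real_part y) (of_real_part x))"
    if "of_real_part x \<in> E" "of_real_part y \<in> E" for x y
  proof -
    have "\<alpha> (of_real_part x) (of_real_part y) + cnj (\<alpha> (of_real_part y) (of_real_part x)) = 0"
      using skew that unfolding skew_hermitian_on_def by (metis cconj_of_real_part)
    then show ?thesis by (simp add: complex_eq_iff)
  qed
  have "nondegenerate_on (real_points (E \<inter> cconj ` E))
         (\<lambda>x y. Im (\<alpha> (of_real_part x) (of_real_part y)))"
    unfolding nondegenerate_on_def Ball_def mem_real_points_iff using left symm by metis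
  with E sum bil skew L_minus show ?thesis by blast
qed

text \<open>Condition (i) gives isotropy. Condition (ii) gives both injectivity and surjectivity of
  the real part.\<close>

lemma L_minus_imp_holomorphic_space:
  fixes E :: "'v::real_vector complexification set"
  assumes fin: "finite B" "span B = (UNIV :: 'v set)"
    and L: "complexification.subspace (L_minus E \<alpha>)"
    and E: "complexification.subspace E" and sum: "E + cconj ` E = UNIV"
    and bil: "cbilinear_on E (cconj ` E) \<alpha>"
    and skew: "skew_hermitian_on E \<alpha>"
    and nondeg: "nondegenerate_on (real_points (E \<inter> cconj ` E))
         (\<lambda>x y. Im (\<alpha> (of_real_part x) (of_real_part y)))"
  shows "\<exists>J. symmetric_gcs J \<and> L_minus E \<alpha> = holomorphic_space J"
proof (rule symmetric_gcs_of_real_part_bij [OF L])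
  let ?F = "cconj ` E"
  note F = subspace_cconj_image [OF E]
  have onto: "\<exists>q\<in>?F. re_part q = v" for v
    using re_part_onto [OF E sum, of v] by auto
  note add1 = cbilinear_onD(1) [OF bil] and add2 = cbilinear_onD(2) [OF bil]
    and scale1 = cbilinear_onD(3) [OF bil] and scale2 = cbilinear_onD(4) [OF bil]
  have inF: "of_real_part y \<in> ?F" if "of_real_part y \<in> E" for y
    using that by (simp add: mem_cconj_image_iff)
  have left: "x = 0"
    if "of_real_part x \<in> E"
      "\<And>y. of_real_part y \<in> E \<Longrightarrow> Im (\<alpha> (of_real_part x) (of_real_part y)) = 0" for x
    using nondeg that unfolding nondegenerate_on_def Ball_def mem_real_points_iff by blast
  have of_real_add: "of_real_part (x + y) = of_real_part x + of_real_part y"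
    and of_real_scale: "of_real_part (r *\<^sub>R x) = cscale (of_real r) (of_real_part x)"
    for x y :: 'v and r
    by (simp_all add: complexification_eq_iff)

  show "herm w z = 0" if "w \<in> L_minus E \<alpha>" "z \<in> L_minus E \<alpha>" for w z
  proof -
    have E: "vec_part w \<in> E" "vec_part z \<in> E"
      using that by (simp_all add: L_minus_iff)
    have "cdual_apply (form_part w) (cconj (vec_part z)) = \<alpha> (vec_part w) (cconj (vec_part z))"
      "cdual_apply (form_part z) (cconj (vec_part w)) = \<alpha> (vec_part z) (cconj (vec_part w))"
      using that E unfolding L_minus_iff by blast+
    then show ?thesis
      using skew E by (simp add: herm_def skew_hermitian_on_def)
  qed

  show "w = 0" if w: "w \<in> L_minus E \<alpha>" and re: "re_part w = 0" for w
  proof -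
    \<comment> \<open>Here \<open>w\<close> is \<open>\<i>\<close> times the real vector
      \<open>(x, \<zeta>)\<close>, so \<open>\<alpha>(x, -)\<close> equals \<open>\<zeta>\<close> on
      \<open>?F\<close> and is real on \<open>\<Delta>\<close>. This puts \<open>x\<close> in the
      kernel; then \<open>\<zeta>\<close> vanishes on \<open>?F\<close>, whose real parts fill
      \<open>V\<close>.\<close>
    define x \<zeta> where "x = fst (im_part w)" and "\<zeta> = snd (im_part w)"
    have parts: "vec_part w = cscale \<i> (of_real_part x)"
      "form_part w = cscale \<i> (of_real_part \<zeta>)"
      by (simp_all add: complexification_eq_iff x_def \<zeta>_def re)
    have "of_real_part x = cscale (- \<i>) (vec_part w)"
      by (simp add: parts complexification_eq_iff)
    moreover have "vec_part w \<in> E"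
      using w by (simp add: L_minus_iff)
    ultimately have xE: "of_real_part x \<in> E"
      using complexification.subspace_scale [OF E] by metis
    have \<zeta>: "cdual_apply (of_real_part \<zeta>) q = \<alpha> (of_real_part x) q" if q: "q \<in> ?F" for q
    proof -
      have "cdual_apply (cscale \<i> (of_real_part \<zeta>)) q = \<i> * \<alpha> (of_real_part x) q"
        using w q scale1 [OF xE q] by (simp add: L_minus_iff parts)
      then show ?thesis by (simp add: cdual_apply_bilinear)
    qed
    have "x = 0"
    proof (rule left [OF xE])
      fix y :: 'v assume "of_real_part y \<in> E"
      from \<zeta> [OF inF [OF this], symmetric]
      show "Im (\<alpha> (of_real_part x) (of_real_part y)) = 0" by simp
    qed
    then have "of_real_part x = cscale 0 (of_real_part x)"
      by (simp add: complexification_eq_iff)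
    then have "cdual_apply (of_real_part \<zeta>) q = 0" if "q \<in> ?F" for q
      using \<zeta> [OF that] scale1 [OF xE that, of 0] by simp
    then have "Re (cdual_apply (of_real_part \<zeta>) q) = 0" if "q \<in> ?F" for q
      using that by simp
    then have "dual_apply \<zeta> (re_part q) = 0" if "q \<in> ?F" for q
      using that by simp
    then have "dual_apply \<zeta> v = 0" for v
      using onto [of v] by blast
    then have "\<zeta> = 0"
      by (simp add: dual_apply_inject [symmetric] fun_eq_iff)
    with \<open>x = 0\<close> show "w = 0"
      by (simp add: complexification_eq_iff re x_def \<zeta>_def prod_eq_iff)
  qed

  show "\<exists>w\<in>L_minus E \<alpha>. re_part w = u" for u
  proof -
    obtain v \<theta> where u: "u = (v, \<theta>)" by (cases u)
    obtain X where X: "X \<in> E" "re_part X = v"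
      using re_part_onto [OF E sum, of v] by blast
    let ?D = "real_points (E \<inter> ?F)"
    \<comment> \<open>The vector part may be any \<open>X + \<i> x\<close> with \<open>x\<close> in
      \<open>\<Delta>\<close>. A form with real part \<open>\<theta>\<close> exists over it when
      \<open>Re (\<alpha>(X + \<i> x, y)) = \<theta> y\<close> on \<open>\<Delta>\<close>; expanding
      the left side as \<open>Re (\<alpha>(X, y)) - Im (\<alpha>(x, y))\<close> gives this equation
      for \<open>x\<close>.\<close>
    have "\<exists>x\<in>?D. \<forall>y\<in>?D. Im (\<alpha> (of_real_part x) (of_real_part y))
        = Re (\<alpha> X (of_real_part y)) - dual_apply \<theta> y"
    proof (rule nondegenerate_represents [OF fin(1)])
      show "?D \<subseteq> span B" by (simp add: fin)
      show "subspace ?D"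
        by (intro subspace_real_points complexification.subspace_inter E F)
      show "x = 0" if "x \<in> ?D"
        "\<And>y. y \<in> ?D \<Longrightarrow> Im (\<alpha> (of_real_part x) (of_real_part y)) = 0" for x
        using left that by (simp add: mem_real_points_iff)
    qed (simp_all add: mem_real_points_iff of_real_add of_real_scale add1 add2 scale1 scale2 inF X
        algebra_simps)
    then obtain x where x: "x \<in> ?D"
      and rep: "\<forall>y\<in>?D. Im (\<alpha> (of_real_part x) (of_real_part y))
        = Re (\<alpha> X (of_real_part y)) - dual_apply \<theta> y"
      by (rule bexE)
    have xE: "of_real_part x \<in> E" using x by (simp add: mem_real_points_iff)
    define X' where "X' = X + cscale \<i> (of_real_part x)"
    have ixE: "cscale \<i> (of_real_part x) \<in> E"
      using xE complexification.subspace_scale [OF E] by blast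
    have X': "X' \<in> E" "re_part X' = v"
      using X ixE complexification.subspace_add [OF E] by (auto simp: X'_def)
    \<comment> \<open>This is \<open>\<theta> + \<i> \<zeta> = \<alpha> X'\<close> on
      \<open>?F\<close>, solved for \<open>\<zeta>\<close>; the choice of \<open>x\<close> makes the
      solution real on \<open>\<Delta>\<close>.\<close>
    let ?\<phi> = "\<lambda>q. - \<i> * (\<alpha> X' q - cdual_apply (of_real_part \<theta>) q)"
    have "\<exists>\<zeta>. \<forall>q\<in>?F. cdual_apply (of_real_part \<zeta>) q = ?\<phi> q"
    proof (rule real_covector_extension [OF F onto])
      show "?\<phi> (p + q) = ?\<phi> p + ?\<phi> q" if "p \<in> ?F" "q \<in> ?F" for p q
        using that X' by (simp add: add2 cdual_apply_bilinear algebra_simps)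
      show "?\<phi> (cscale c q) = c * ?\<phi> q" if "q \<in> ?F" for c q
        using that X' by (simp add: scale2 cdual_apply_bilinear algebra_simps)
      show "Im (?\<phi> (of_real_part y)) = 0" if "of_real_part y \<in> ?F" for y
        using that bspec [OF rep, of y] X(1) xE ixE
        by (simp add: mem_real_points_iff mem_cconj_image_iff X'_def add1 scale1)
    qed
    then obtain \<zeta> where \<zeta>: "\<forall>q\<in>?F. cdual_apply (of_real_part \<zeta>) q = ?\<phi> q"
      by (rule exE)
    let ?w = "Cplx (v, \<theta>) (im_part X', \<zeta>)"
    have "vec_part ?w = X'" by (simp add: complexification_eq_iff X')
    moreover have "cdual_apply (form_part ?w) q = \<alpha> X' q" if "q \<in> ?F" for q
    proof -
      have "cdual_apply (form_part ?w) q
          = cdual_apply (of_real_part \<theta>) q + \<i> * cdual_apply (of_real_part \<zeta>) q"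
        by (simp add: complex_eq_iff)
      then show ?thesis by (simp add: bspec [OF \<zeta> that] algebra_simps)
    qed
    ultimately have "?w \<in> L_minus E \<alpha>" by (simp add: L_minus_iff X')
    then show ?thesis by (rule bexI [rotated]) (simp add: u)
  qed
qed

theorem proposition4:
  fixes L :: "('v::real_vector \<times> 'v dual) complexification set"
  assumes "\<exists>B :: 'v set. finite B \<and> span B = UNIV"
    and "complexification.subspace L"
  shows "(\<exists>J. symmetric_gcs J \<and> L = holomorphic_space J) \<longleftrightarrow>
    (\<exists>E \<alpha>. complexification.subspace E \<and> E + cconj ` E = UNIV \<and>
       cbilinear_on E (cconj ` E) \<alpha> \<and>
       skew_hermitian_on E \<alpha> \<and>
       nondegenerate_on (real_points (E \<inter> cconj ` E))
         (\<lambda>x y. Im (\<alpha> (of_real_part x) (of_real_part y))) \<and>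
       L = L_minus E \<alpha>)"
proof
  assume "\<exists>J. symmetric_gcs J \<and> L = holomorphic_space J"
  then obtain J where J: "symmetric_gcs J" "L = holomorphic_space J"
    by (elim exE conjE)
  show "\<exists>E \<alpha>. complexification.subspace E \<and> E + cconj ` E = UNIV \<and>
       cbilinear_on E (cconj ` E) \<alpha> \<and>
       skew_hermitian_on E \<alpha> \<and>
       nondegenerate_on (real_points (E \<inter> cconj ` E))
         (\<lambda>x y. Im (\<alpha> (of_real_part x) (of_real_part y))) \<and>
       L = L_minus E \<alpha>"
    by (rule holomorphic_space_imp_L_minus [OF assms(2) J])
next
  assume "\<exists>E \<alpha>. complexification.subspace E \<and> E + cconj ` E = UNIV \<and>
       cbilinear_on E (cconj ` E) \<alpha> \<and>
       skew_hermitian_on E \<alpha> \<and>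
       nondegenerate_on (real_points (E \<inter> cconj ` E))
         (\<lambda>x y. Im (\<alpha> (of_real_part x) (of_real_part y))) \<and>
       L = L_minus E \<alpha>"
  then obtain E \<alpha> where E: "complexification.subspace E" "E + cconj ` E = UNIV"
      "cbilinear_on E (cconj ` E) \<alpha>" "skew_hermitian_on E \<alpha>"
      "nondegenerate_on (real_points (E \<inter> cconj ` E))
         (\<lambda>x y. Im (\<alpha> (of_real_part x) (of_real_part y)))"
    and L: "L = L_minus E \<alpha>"
    by (elim exE conjE)
  obtain B :: "'v set" where B: "finite B" "span B = UNIV"
    using assms(1) by (elim exE conjE)
  show "\<exists>J. symmetric_gcs J \<and> L = holomorphic_space J"
    using L_minus_imp_holomorphic_space [OF B assms(2) [unfolded L] E] by (simp only: L)
qed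

end
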